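(* Let $f,h$ be smooth, nowhere zero functions of $t$ on an open interval satisfying, for some constants $K$ and $C\neq0$, $$h=C\Big[f^2\exp\Big(-\int\frac Kf\,dt\Big)\Big]^{1/3}.$$ For a smooth function $w=w(z)$ put $$u=\frac1{f^{2/3}}\Big[w(z)-\frac{y^2f'(K-2f')}{18f^{4/3}}-\frac{-6Kx+6xf'+3y^2f''}{18f^{1/3}}\Big],\qquad z=\frac{12xf+y^2(K-2f')}{f^{4/3}}.$$ Then $u$ is invariant under both $\mathbf y_h$ and $\mathbf z_f$, and $u$ solves the ZK equation $u_{xt}-(uu_x)_x-u_{yy}=0$ if and only if $w$ satisfies $$K^2+90Kw'+1296w'^2+36(36w+Kz)w''=0.$$ For $K=0$ this equation reduces to $w'^2+ww''=0$, with solution $w=\beta\sqrt{2z-\alpha}$ ($\alpha,\beta$ constants), and the corresponding solution of the ZK equation is $$u=\frac1{18f^2}\Big[2y^2f'^2-3f(2xf'+y^2f'')+18\beta f^{4/3}\Big(4\,\frac{6xf-y^2f'}{f^{4/3}}-\alpha\Big)^{1/2}\Big].$$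
   Context: Vector fields on $(t,x,y,u)$-space: $\mathbf y_h=\tfrac12 yh'\partial_x+h\partial_y-\tfrac12 yh''\partial_u$, $\mathbf z_f=f\partial_t+\tfrac16(2xf'+y^2f'')\partial_x+\tfrac{2y}{3}f'\partial_y+\tfrac16(-4uf'-2xf''-y^2f''')\partial_u$. Primes on $f,h$ denote $d/dt$, primes on $w$ denote $d/dz$. Powers with denominator 3 are real ones; the square-root solutions are considered where the radicand is positive. A function $u(t,x,y)$ is invariant under a vector field if the field is tangent to its graph. *)

theory Defs
  imports "HOL-Analysis.Analysis"
begin

(* Real powers with denominator 3 are rendered as a^(k/3) = root 3 a ^ k; on odd
   roots the library function is the real one, also for negative a. *)

(* Meant for open S: the derivatives are taken at points of S in the whole space. *)
primrec C_on :: "nat \<Rightarrow> 'a::euclidean_space set \<Rightarrow> ('a \<Rightarrow> real) \<Rightarrow> bool" where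
  "C_on 0 S g \<longleftrightarrow> continuous_on S g"
| "C_on (Suc n) S g \<longleftrightarrow>
     (\<forall>p\<in>S. g differentiable (at p)) \<and>
     (\<forall>v. C_on n S (\<lambda>p. frechet_derivative g (at p) v))"

definition smooth_on :: "'a::euclidean_space set \<Rightarrow> ('a \<Rightarrow> real) \<Rightarrow> bool" where
  "smooth_on S g \<longleftrightarrow> (\<forall>n. C_on n S g)"

(* Points of the space of independent variables are triples (t, x, y), and points of
   (t,x,y,u)-space are quadruples. A vector field
   a \<partial>_t + b \<partial>_x + c \<partial>_y + d \<partial>_u
   is the map sending a point to (a, b, c, d). *)
type_synonym pt = "real \<times> real \<times> real"
type_synonym vfield = "real \<times> real \<times> real \<times> real \<Rightarrow> real \<times> real \<times> real \<times> real"

definition vf_y :: "(real \<Rightarrow> real) \<Rightarrow> vfield" where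
  "vf_y h = (\<lambda>(t, x, y, u).
     (0,
      1 / 2 * y * deriv h t,
      h t,
      - 1 / 2 * y * (deriv ^^ 2) h t))"

definition vf_z :: "(real \<Rightarrow> real) \<Rightarrow> vfield" where
  "vf_z f = (\<lambda>(t, x, y, u).
     (f t,
      1 / 6 * (2 * x * deriv f t + y\<^sup>2 * (deriv ^^ 2) f t),
      2 * y / 3 * deriv f t,
      1 / 6 * (- 4 * u * deriv f t - 2 * x * (deriv ^^ 2) f t - y\<^sup>2 * (deriv ^^ 3) f t)))"

(* The field is tangent to the graph of u over D: the tangent space of the graph at
   (p, u p) consists of the vectors (v, L v), where L is the derivative of u at p. *)
definition invariant_on :: "pt set \<Rightarrow> (pt \<Rightarrow> real) \<Rightarrow> vfield \<Rightarrow> bool" where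
  "invariant_on D u X \<longleftrightarrow>
     (\<forall>(t, x, y) \<in> D. \<exists>L. (u has_derivative L) (at (t, x, y)) \<and>
        (\<exists>a b c. X (t, x, y, u (t, x, y)) = (a, b, c, L (a, b, c))))"

definition part_t :: "(pt \<Rightarrow> real) \<Rightarrow> pt \<Rightarrow> real" where
  "part_t u = (\<lambda>(t, x, y). deriv (\<lambda>s. u (s, x, y)) t)"

definition part_x :: "(pt \<Rightarrow> real) \<Rightarrow> pt \<Rightarrow> real" where
  "part_x u = (\<lambda>(t, x, y). deriv (\<lambda>s. u (t, s, y)) x)"

definition part_y :: "(pt \<Rightarrow> real) \<Rightarrow> pt \<Rightarrow> real" where
  "part_y u = (\<lambda>(t, x, y). deriv (\<lambda>s. u (t, x, s)) y)"

definition solves_ZK :: "pt set \<Rightarrow> (pt \<Rightarrow> real) \<Rightarrow> bool" where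
  "solves_ZK D u \<longleftrightarrow> smooth_on D u \<and>
     (\<forall>p\<in>D. part_t (part_x u) p - part_x (\<lambda>q. u q * part_x u q) p - part_y (part_y u) p = 0)"

definition zvar :: "real \<Rightarrow> (real \<Rightarrow> real) \<Rightarrow> pt \<Rightarrow> real" where
  "zvar K f = (\<lambda>(t, x, y).
     (12 * x * f t + y\<^sup>2 * (K - 2 * deriv f t)) / root 3 (f t) ^ 4)"

definition ansatz :: "real \<Rightarrow> (real \<Rightarrow> real) \<Rightarrow> (real \<Rightarrow> real) \<Rightarrow> pt \<Rightarrow> real" where
  "ansatz K f w = (\<lambda>(t, x, y).
     1 / root 3 (f t) ^ 2 *
       (w (zvar K f (t, x, y))
        - y\<^sup>2 * deriv f t * (K - 2 * deriv f t) / (18 * root 3 (f t) ^ 4)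
        - (- 6 * K * x + 6 * x * deriv f t + 3 * y\<^sup>2 * (deriv ^^ 2) f t) / (18 * root 3 (f t))))"

definition radicand :: "(real \<Rightarrow> real) \<Rightarrow> real \<Rightarrow> pt \<Rightarrow> real" where
  "radicand f \<alpha> = (\<lambda>(t, x, y).
     4 * ((6 * x * f t - y\<^sup>2 * deriv f t) / root 3 (f t) ^ 4) - \<alpha>)"

definition sqrt_solution :: "(real \<Rightarrow> real) \<Rightarrow> real \<Rightarrow> real \<Rightarrow> pt \<Rightarrow> real" where
  "sqrt_solution f \<alpha> \<beta> = (\<lambda>(t, x, y).
     1 / (18 * (f t)\<^sup>2) *
       (2 * y\<^sup>2 * (deriv f t)\<^sup>2
        - 3 * f t * (2 * x * deriv f t + y\<^sup>2 * (deriv ^^ 2) f t)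
        + 18 * \<beta> * root 3 (f t) ^ 4 * sqrt (radicand f \<alpha> (t, x, y))))"

definition reduced_ODE_at :: "real \<Rightarrow> (real \<Rightarrow> real) \<Rightarrow> real \<Rightarrow> bool" where
  "reduced_ODE_at K w z \<longleftrightarrow>
     K\<^sup>2 + 90 * K * deriv w z + 1296 * (deriv w z)\<^sup>2
       + 36 * (36 * w z + K * z) * (deriv ^^ 2) w z = 0"

definition reduced_ODE0_at :: "(real \<Rightarrow> real) \<Rightarrow> real \<Rightarrow> bool" where
  "reduced_ODE0_at w z \<longleftrightarrow> (deriv w z)\<^sup>2 + w z * (deriv ^^ 2) w z = 0"

end

theory Submission
  imports Defs
begin

text \<open>Put \<open>R = f\<^bsup>-1/3\<^esup>\<close>. Then \<open>R' = - f' R\<^sup>4 / 3\<close>, so \<open>z\<close> and \<open>u\<close> and all their partial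
  derivatives are polynomials in \<open>R\<close>, \<open>x\<close>, \<open>y\<close>, the derivatives of \<open>f\<close>, and \<open>w\<close>, \<open>w'\<close>, \<open>w''\<close> at \<open>z\<close>.
  Collecting terms, the left-hand side of the ZK equation is \<open>- R\<^sup>6 / 9\<close> times that of the reduced
  equation at \<open>z\<close>; as \<open>R\<close> has no zeros and every \<open>z\<close> is attained (at \<open>y = 0\<close>), the two equations are
  equivalent. Invariance is tangency \<open>X u = \<eta>\<close> computed from the same partials, with
  \<open>h' = h (2 f' - K) / (3 f)\<close>, the logarithmic derivative of the formula for \<open>h\<close>.\<close>

subsection \<open>Smooth functions\<close>

text \<open>On an open set a Frechet derivative depends only on nearby values, so equality on
  \<open>S\<close> passes to the directional derivatives and the induction goes through.\<close>

lemma C_on_cong: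
  assumes "C_on n S g" and "open S" and "\<And>p. p \<in> S \<Longrightarrow> g p = g' p"
  shows "C_on n S g'"
  using assms
proof (induction n arbitrary: g g')
  case 0
  then show ?case
    using continuous_on_cong by (metis C_on.simps(1))
next
  case (Suc n)
  have diff: "g differentiable (at p)" if "p \<in> S" for p
    using Suc.prems(1) that by simp
  have der: "(g' has_derivative frechet_derivative g (at p)) (at p)" if "p \<in> S" for p
    using diff[OF that] Suc.prems(2,3) that
    by (metis frechet_derivative_works has_derivative_transform_within_open)
  have d: "g' differentiable (at p)" "frechet_derivative g (at p) = frechet_derivative g' (at p)"
    if "p \<in> S" for p
    by (rule differentiableI[OF der[OF that]], rule frechet_derivative_at[OF der[OF that]])
  have "C_on n S (\<lambda>p. frechet_derivative g' (at p) v)" for v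
    by (rule Suc.IH[of "\<lambda>p. frechet_derivative g (at p) v"]) (use Suc.prems(1,2) d(2) in auto)
  then show ?case
    using d(1) by simp
qed

text \<open>By uniqueness of the derivative, any explicit \<open>g'\<close> may stand in for
  \<open>frechet_derivative\<close>. The closure properties below are obtained through this
  rule.\<close>

lemma C_on_SucI:
  assumes "open S" and der: "\<And>p. p \<in> S \<Longrightarrow> (g has_derivative g' p) (at p)"
    and "\<And>v. C_on n S (\<lambda>p. g' p v)"
  shows "C_on (Suc n) S g"
proof -
  have "g' p = frechet_derivative g (at p)" if "p \<in> S" for p
    using der[OF that] by (rule frechet_derivative_at)
  then have "C_on n S (\<lambda>p. frechet_derivative g (at p) v)" for v
    using C_on_cong[OF assms(3)[of v] assms(1)] by simp
  then show ?thesis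
    using differentiableI[OF der] by simp
qed

text \<open>The product and chain rules mix a function with its derivatives, so the function itself
  is needed at the lower order. The base case is that differentiability implies continuity.\<close>

lemma C_on_SucD: "C_on (Suc n) S g \<Longrightarrow> C_on n S g"
proof (induction n arbitrary: g)
  case 0
  then show ?case
    by (auto intro!: continuous_at_imp_continuous_on differentiable_imp_continuous_within)
next
  case (Suc n)
  then show ?case
    by (metis C_on.simps(2))
qed

lemma C_on_Suc_has_derivative:
  "C_on (Suc n) S g \<Longrightarrow> p \<in> S \<Longrightarrow> (g has_derivative frechet_derivative g (at p)) (at p)"
  by (simp add: frechet_derivative_works)

lemma C_on_const: "open S \<Longrightarrow> C_on n S (\<lambda>p. c)"
proof (induction n arbitrary: c)
  case (Suc n)
  then show ?case
    by (intro C_on_SucI[where g' = "\<lambda>_ _. 0"]) auto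
qed simp

text \<open>A bounded linear map is its own derivative at every point, so its directional
  derivatives are constant.\<close>

lemma C_on_bounded_linear:
  assumes "open S" and "bounded_linear g"
  shows "C_on n S g"
proof (cases n)
  case 0
  then show ?thesis
    using assms(2) by (simp add: linear_continuous_on)
next
  case (Suc m)
  then show ?thesis
    using assms C_on_SucI[of S g "\<lambda>_. g"] bounded_linear_imp_has_derivative C_on_const by blast
qed

lemma C_on_add:
  assumes "open S" and "C_on n S g" and "C_on n S k"
  shows "C_on n S (\<lambda>p. g p + k p)"
  using assms(2,3)
proof (induction n arbitrary: g k)
  case 0
  then show ?case
    by (simp add: continuous_on_add)
next
  case (Suc n)
  show ?case
  proof (rule C_on_SucI[OF assms(1)])
    show "((\<lambda>p. g p + k p) has_derivative
        (\<lambda>v. frechet_derivative g (at p) v + frechet_derivative k (at p) v)) (at p)"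
      if "p \<in> S" for p
      using Suc.prems that by (intro has_derivative_add C_on_Suc_has_derivative)
    show "C_on n S (\<lambda>p. frechet_derivative g (at p) v + frechet_derivative k (at p) v)" for v
      using Suc.prems by (intro Suc.IH) auto
  qed
qed

lemma C_on_mult:
  assumes "open S" and "C_on n S g" and "C_on n S k"
  shows "C_on n S (\<lambda>p. g p * k p)"
  using assms(2,3)
proof (induction n arbitrary: g k)
  case 0
  then show ?case
    by (simp add: continuous_on_mult)
next
  case (Suc n)
  show ?case
  proof (rule C_on_SucI[OF assms(1)])
    show "((\<lambda>p. g p * k p) has_derivative
        (\<lambda>v. g p * frechet_derivative k (at p) v + frechet_derivative g (at p) v * k p)) (at p)"
      if "p \<in> S" for p
      using Suc.prems that by (intro has_derivative_mult C_on_Suc_has_derivative)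
    show "C_on n S (\<lambda>p. g p * frechet_derivative k (at p) v + frechet_derivative g (at p) v * k p)" for v
      using Suc.prems C_on_SucD by (intro C_on_add assms(1) Suc.IH) auto
  qed
qed

section \<open>Smooth functions of one real variable and composition with them\<close>

lemma frechet_derivative_real:
  fixes \<phi> :: "real \<Rightarrow> real"
  assumes "\<phi> differentiable (at z)"
  shows "frechet_derivative \<phi> (at z) v = deriv \<phi> z * v"
proof -
  have "(\<phi> has_derivative (*) (deriv \<phi> z)) (at z)"
    using assms by (metis DERIV_deriv_iff_real_differentiable has_field_derivative_def)
  then show ?thesis
    by (metis frechet_derivative_at)
qed

text \<open>In one variable every directional derivative is a multiple of
  \<open>deriv \<phi>\<close>. This links \<open>C_on\<close> to the iterated \<open>deriv\<close>
  in which the vector fields and the reduced equation are written.\<close>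

lemma C_on_real_Suc_iff:
  fixes \<phi> :: "real \<Rightarrow> real"
  assumes "open T"
  shows "C_on (Suc n) T \<phi> \<longleftrightarrow>
    (\<forall>z\<in>T. (\<phi> has_real_derivative deriv \<phi> z) (at z)) \<and> C_on n T (deriv \<phi>)"
    (is "?L \<longleftrightarrow> ?R")
proof
  assume ?L
  then have d: "\<forall>z\<in>T. \<phi> differentiable (at z)" and "C_on n T (\<lambda>z. frechet_derivative \<phi> (at z) 1)"
    by simp_all
  then have "C_on n T (deriv \<phi>)"
    using C_on_cong[OF _ assms, of n "\<lambda>z. frechet_derivative \<phi> (at z) 1" "deriv \<phi>"]
    by (simp add: frechet_derivative_real)
  with d show ?R
    by (simp add: DERIV_deriv_iff_real_differentiable)
next
  assume ?R
  then show ?L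
    using assms by (intro C_on_SucI[where g' = "\<lambda>z v. deriv \<phi> z * v"] C_on_mult C_on_const)
      (auto simp: has_field_derivative_def)
qed

text \<open>By the chain rule the derivative is \<open>deriv \<phi>\<close> composed with
  \<open>g\<close>, times that of \<open>g\<close>. The induction varies \<open>\<phi>\<close>, so
  its hypothesis covers the first factor.\<close>

lemma C_on_compose:
  fixes \<phi> :: "real \<Rightarrow> real"
  assumes "open S" and "open T" and "\<And>p. p \<in> S \<Longrightarrow> g p \<in> T"
    and "C_on n T \<phi>" and "C_on n S g"
  shows "C_on n S (\<lambda>p. \<phi> (g p))"
  using assms(4,5)
proof (induction n arbitrary: \<phi>)
  case 0
  then show ?case
    using assms(3) by (auto intro: continuous_on_compose2)
next
  case (Suc n)
  have \<phi>: "\<And>z. z \<in> T \<Longrightarrow> (\<phi> has_real_derivative deriv \<phi> z) (at z)" "C_on n T (deriv \<phi>)"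
    using Suc.prems(1) C_on_real_Suc_iff[OF assms(2)] by blast+
  show ?case
  proof (rule C_on_SucI[OF assms(1)])
    show "((\<lambda>p. \<phi> (g p)) has_derivative (\<lambda>v. deriv \<phi> (g p) * frechet_derivative g (at p) v)) (at p)"
      if "p \<in> S" for p
      using has_derivative_compose[OF C_on_Suc_has_derivative[OF Suc.prems(2) that]
          \<phi>(1)[OF assms(3)[OF that], unfolded has_field_derivative_def]] .
    show "C_on n S (\<lambda>p. deriv \<phi> (g p) * frechet_derivative g (at p) v)" for v
      by (rule C_on_mult[OF assms(1) Suc.IH[OF \<phi>(2) C_on_SucD[OF Suc.prems(2)]]])
        (use Suc.prems(2) in simp)
  qed
qed

lemma C_on_realI:
  assumes "open T" and "\<And>z. z \<in> T \<Longrightarrow> (\<phi> has_real_derivative \<psi> z) (at z)"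
    and "C_on n T \<psi>"
  shows "C_on (Suc n) T \<phi>"
  using assms by (intro C_on_SucI[where g' = "\<lambda>z v. \<psi> z * v"] C_on_mult C_on_const)
    (auto simp: has_field_derivative_def)

lemma smooth_on_realD:
  fixes \<phi> :: "real \<Rightarrow> real"
  assumes "open T" and "smooth_on T \<phi>"
  shows "\<And>z. z \<in> T \<Longrightarrow> (\<phi> has_real_derivative deriv \<phi> z) (at z)" and "smooth_on T (deriv \<phi>)"
proof -
  have "C_on (Suc n) T \<phi>" for n
    using assms(2) smooth_on_def by blast
  then have "(\<forall>z\<in>T. (\<phi> has_real_derivative deriv \<phi> z) (at z)) \<and> C_on n T (deriv \<phi>)" for n
    unfolding C_on_real_Suc_iff[OF assms(1)] .
  then show "\<And>z. z \<in> T \<Longrightarrow> (\<phi> has_real_derivative deriv \<phi> z) (at z)" "smooth_on T (deriv \<phi>)"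
    by (auto simp: smooth_on_def)
qed

lemma smooth_on_const: "open S \<Longrightarrow> smooth_on S (\<lambda>p. c)"
  by (simp add: smooth_on_def C_on_const)

lemma smooth_on_bounded_linear: "open S \<Longrightarrow> bounded_linear g \<Longrightarrow> smooth_on S g"
  by (simp add: smooth_on_def C_on_bounded_linear)

lemma smooth_on_add:
  "open S \<Longrightarrow> smooth_on S g \<Longrightarrow> smooth_on S k \<Longrightarrow> smooth_on S (\<lambda>p. g p + k p)"
  by (simp add: smooth_on_def C_on_add)

lemma smooth_on_mult:
  "open S \<Longrightarrow> smooth_on S g \<Longrightarrow> smooth_on S k \<Longrightarrow> smooth_on S (\<lambda>p. g p * k p)"
  by (simp add: smooth_on_def C_on_mult)

lemma smooth_on_diff:
  "open S \<Longrightarrow> smooth_on S g \<Longrightarrow> smooth_on S k \<Longrightarrow> smooth_on S (\<lambda>p. g p - k p)"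
  using smooth_on_add[of S g "\<lambda>p. - 1 * k p"] smooth_on_mult[of S "\<lambda>p. - 1" k] smooth_on_const[of S "- 1"]
  by simp

lemma smooth_on_power: "open S \<Longrightarrow> smooth_on S g \<Longrightarrow> smooth_on S (\<lambda>p. g p ^ m)"
  by (induction m) (simp_all add: smooth_on_const smooth_on_mult)

lemma smooth_on_compose:
  fixes \<phi> :: "real \<Rightarrow> real"
  assumes "smooth_on T \<phi>" and "open T" and "open S" and "smooth_on S g"
    and "\<And>p. p \<in> S \<Longrightarrow> g p \<in> T"
  shows "smooth_on S (\<lambda>p. \<phi> (g p))"
  unfolding smooth_on_def
proof
  show "C_on n S (\<lambda>p. \<phi> (g p))" for n
    by (rule C_on_compose[OF assms(3,2,5)]) (use assms(1,4) in \<open>auto simp: smooth_on_def\<close>)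
qed

lemma smooth_on_cong:
  "smooth_on S g \<Longrightarrow> open S \<Longrightarrow> (\<And>p. p \<in> S \<Longrightarrow> g p = g' p) \<Longrightarrow> smooth_on S g'"
  unfolding smooth_on_def by (intro allI) (rule C_on_cong[of _ S g], auto)

section \<open>Smoothness of inverse, square root and cube root\<close>

lemma open_nonzero: "open {z :: real. z \<noteq> 0}"
  by (simp add: open_Collect_neq)

text \<open>Bootstrapping: the derivative is a polynomial in \<open>inverse\<close> itself, so order
  \<open>n\<close> for the function gives order \<open>n\<close> for its derivative.\<close>

lemma smooth_on_inverse: "smooth_on {z :: real. z \<noteq> 0} inverse"
proof -
  have "C_on n {z :: real. z \<noteq> 0} inverse" for n
  proof (induction n)
    case (Suc n)
    show ?case
    proof (rule C_on_realI[OF open_nonzero])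
      show "(inverse has_real_derivative - 1 * (inverse z * inverse z)) (at z)"
        if "z \<in> {z. z \<noteq> 0}" for z
        using that by (auto intro!: derivative_eq_intros)
      show "C_on n {z. z \<noteq> 0} (\<lambda>z :: real. - 1 * (inverse z * inverse z))"
        by (intro C_on_mult C_on_const open_nonzero Suc.IH)
    qed
  qed (auto intro: continuous_intros)
  then show ?thesis
    by (simp add: smooth_on_def)
qed

lemma C_on_inverse:
  fixes g :: "'a::euclidean_space \<Rightarrow> real"
  assumes "open S" and "C_on n S g" and "\<And>p. p \<in> S \<Longrightarrow> g p \<noteq> 0"
  shows "C_on n S (\<lambda>p. inverse (g p))"
  by (rule C_on_compose[OF assms(1) open_nonzero])
    (use assms smooth_on_inverse in \<open>auto simp: smooth_on_def\<close>)

text \<open>The same bootstrapping, with a derivative that is a multiple of the inverse of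
  \<open>sqrt\<close>.\<close>

lemma smooth_on_sqrt: "smooth_on {0<..} sqrt"
proof -
  have "C_on n {0<..} sqrt" for n
  proof (induction n)
    case (Suc n)
    show ?case
    proof (rule C_on_realI[OF open_greaterThan])
      show "(sqrt has_real_derivative 1 / 2 * inverse (sqrt z)) (at z)" if "z \<in> {0<..}" for z
        using that by (auto intro!: derivative_eq_intros)
      show "C_on n {0<..} (\<lambda>z. 1 / 2 * inverse (sqrt z))"
        by (intro C_on_mult C_on_const C_on_inverse open_greaterThan Suc.IH) auto
    qed
  qed (auto intro: continuous_intros)
  then show ?thesis
    by (simp add: smooth_on_def)
qed

lemma has_real_derivative_root3:
  assumes "z \<noteq> 0"
  shows "(root 3 has_real_derivative 1 / 3 * inverse (root 3 z ^ 2)) (at z)"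
  using DERIV_odd_real_root[of 3 z] assms by (simp add: inverse_mult_distrib)

lemma smooth_on_root3: "smooth_on {z. z \<noteq> 0} (root 3)"
proof -
  have "C_on n {z. z \<noteq> 0} (root 3)" for n
  proof (induction n)
    case (Suc n)
    show ?case
    proof (rule C_on_realI[OF open_nonzero])
      show "(root 3 has_real_derivative 1 / 3 * inverse (root 3 z ^ 2)) (at z)"
        if "z \<in> {z. z \<noteq> 0}" for z
        using that has_real_derivative_root3 by simp
      show "C_on n {z. z \<noteq> 0} (\<lambda>z. 1 / 3 * inverse (root 3 z ^ 2))"
        unfolding power2_eq_square
        by (intro C_on_mult C_on_const C_on_inverse open_nonzero Suc.IH) auto
    qed
  qed (auto intro: continuous_intros)
  then show ?thesis
    by (simp add: smooth_on_def)
qed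

subsection \<open>Partial derivatives\<close>

text \<open>Equality near \<open>p\<close> restricts to equality along each coordinate line. In
  iterated partials, this allows an inner partial to be replaced by a closed form valid only on
  \<open>D\<close>.\<close>

lemma part_cong:
  assumes "open D" and "\<And>p. p \<in> D \<Longrightarrow> g p = g' p" and "p \<in> D"
  shows "part_t g p = part_t g' p" and "part_x g p = part_x g' p" and "part_y g p = part_y g' p"
proof -
  obtain t x y where p: "p = (t, x, y)"
    by (cases p)
  have ev: "eventually (\<lambda>q. g q = g' q) (nhds (t, x, y))"
    using assms p by (auto simp: eventually_nhds)
  have "eventually (\<lambda>s. g (s, x, y) = g' (s, x, y)) (nhds t)"
    "eventually (\<lambda>s. g (t, s, y) = g' (t, s, y)) (nhds x)"
    "eventually (\<lambda>s. g (t, x, s) = g' (t, x, s)) (nhds y)"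
    by (rule eventually_compose_filterlim[OF ev], intro tendsto_intros filterlim_ident)+
  then show "part_t g p = part_t g' p" "part_x g p = part_x g' p" "part_y g p = part_y g' p"
    unfolding p part_t_def part_x_def part_y_def by (auto intro!: deriv_cong_ev)
qed

lemma solves_ZK_cong:
  assumes "open D" and "\<And>p. p \<in> D \<Longrightarrow> u p = v p" and "solves_ZK D u"
  shows "solves_ZK D v"
proof -
  have x: "part_x u q = part_x v q" if "q \<in> D" for q
    by (rule part_cong(2)[OF assms(1,2) that])
  have y: "part_y u q = part_y v q" if "q \<in> D" for q
    by (rule part_cong(3)[OF assms(1,2) that])
  have xx: "u q * part_x u q = v q * part_x v q" if "q \<in> D" for q
    using assms(2) x that by simp
  have "part_t (part_x u) p = part_t (part_x v) p" if "p \<in> D" for p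
    by (rule part_cong(1)[OF assms(1) x that])
  moreover have "part_x (\<lambda>q. u q * part_x u q) p = part_x (\<lambda>q. v q * part_x v q) p" if "p \<in> D" for p
    by (rule part_cong(2)[OF assms(1) xx that])
  moreover have "part_y (part_y u) p = part_y (part_y v) p" if "p \<in> D" for p
    by (rule part_cong(3)[OF assms(1) y that])
  moreover have "smooth_on D v"
    using smooth_on_cong[OF _ assms(1,2)] assms(3) by (simp add: solves_ZK_def)
  ultimately show ?thesis
    using assms(3) by (simp add: solves_ZK_def)
qed

text \<open>Partials alone would not give a derivative. Once differentiability is known, linearity
  determines \<open>L\<close> from its values on the coordinate axes.\<close>

lemma has_derivative_partials:
  fixes u :: "pt \<Rightarrow> real"
  assumes "u differentiable (at (t, x, y))"
    and "((\<lambda>s. u (s, x, y)) has_real_derivative a) (at t)"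
    and "((\<lambda>s. u (t, s, y)) has_real_derivative b) (at x)"
    and "((\<lambda>s. u (t, x, s)) has_real_derivative c) (at y)"
  shows "(u has_derivative (\<lambda>(\<tau>, \<xi>, \<eta>). a * \<tau> + b * \<xi> + c * \<eta>)) (at (t, x, y))"
proof -
  obtain L where L: "(u has_derivative L) (at (t, x, y))"
    using assms(1) by (auto simp: differentiable_def)
  interpret L: linear L
    using L has_derivative_linear by blast
  \<comment> \<open>Chain rule along the embedded line \<open>s \<mapsto> (s, x, y)\<close>, whose
    derivative is the first axis; the other two axes are treated alike.\<close>
  have "((\<lambda>s. u (s, x, y)) has_derivative (\<lambda>s. L (s, 0, 0))) (at t)"
    by (rule has_derivative_compose[of "\<lambda>s. (s, x, y)" "\<lambda>s. (s, 0, 0)" t UNIV u L, OF _ L])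
      (auto intro!: derivative_eq_intros simp: zero_prod_def)
  then have t: "L (s, 0, 0) = a * s" for s
    using assms(2) has_derivative_unique unfolding has_field_derivative_def by metis
  have "((\<lambda>s. u (t, s, y)) has_derivative (\<lambda>s. L (0, s, 0))) (at x)"
    by (rule has_derivative_compose[of "\<lambda>s. (t, s, y)" "\<lambda>s. (0, s, 0)" x UNIV u L, OF _ L])
      (auto intro!: derivative_eq_intros simp: zero_prod_def)
  then have x: "L (0, s, 0) = b * s" for s
    using assms(3) has_derivative_unique unfolding has_field_derivative_def by metis
  have "((\<lambda>s. u (t, x, s)) has_derivative (\<lambda>s. L (0, 0, s))) (at y)"
    by (rule has_derivative_compose[of "\<lambda>s. (t, x, s)" "\<lambda>s. (0, 0, s)" y UNIV u L, OF _ L])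
      (auto intro!: derivative_eq_intros simp: zero_prod_def)
  then have y: "L (0, 0, s) = c * s" for s
    using assms(4) has_derivative_unique unfolding has_field_derivative_def by metis
  have "L (\<tau>, \<xi>, \<eta>) = a * \<tau> + b * \<xi> + c * \<eta>" for \<tau> \<xi> \<eta>
    using L.add[of "(\<tau>, 0, 0)" "(0, \<xi>, \<eta>)"] L.add[of "(0, \<xi>, 0)" "(0, 0, \<eta>)"] t x y by simp
  then have "L = (\<lambda>(\<tau>, \<xi>, \<eta>). a * \<tau> + b * \<xi> + c * \<eta>)"
    by auto
  with L show ?thesis
    by simp
qed

subsection \<open>The reduction\<close>

text \<open>Plain resolution with these rules builds an explicit derivative, which
  \<open>DERIV_cong\<close> then leaves to be compared with the closed form. The powers 2, 3 and 4
  are those that get differentiated.\<close>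

lemmas polynomial_deriv_rules =
  DERIV_const DERIV_ident DERIV_add DERIV_diff DERIV_minus DERIV_mult DERIV_cdivide
  DERIV_power[where n = 2, simplified] DERIV_power[where n = 3, simplified]
  DERIV_power[where n = 4, simplified]

text \<open>A locale, because the final proof uses it twice: for the given \<open>w\<close>, and
  with \<open>K = 0\<close> for the square-root function on its half-line.\<close>

locale zk_reduction =
  fixes I J :: "real set" and f w :: "real \<Rightarrow> real" and K :: real
  assumes open_I: "open I" and smooth_f: "smooth_on I f" and f_nz: "\<And>t. t \<in> I \<Longrightarrow> f t \<noteq> 0"
    and open_J: "open J" and smooth_w: "smooth_on J w"
begin

section \<open>The ansatz as a polynomial in the inverse cube root of f\<close>

definition R :: "real \<Rightarrow> real" where
  "R t = inverse (root 3 (f t))"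

abbreviation "f1 \<equiv> deriv f"
abbreviation "f2 \<equiv> deriv (deriv f)"
abbreviation "f3 \<equiv> deriv (deriv (deriv f))"
abbreviation "w1 \<equiv> deriv w"
abbreviation "w2 \<equiv> deriv (deriv w)"

definition Z :: "pt \<Rightarrow> real" where
  "Z = (\<lambda>(t, x, y). 12 * x * R t + y\<^sup>2 * (K - 2 * f1 t) * R t ^ 4)"

text \<open>The part of the bracket in the ansatz that does not involve \<open>w\<close>.\<close>

definition P :: "pt \<Rightarrow> real" where
  "P = (\<lambda>(t, x, y). - (y\<^sup>2 * f1 t * (K - 2 * f1 t) * R t ^ 4) / 18
      - (- 6 * K * x + 6 * x * f1 t + 3 * y\<^sup>2 * f2 t) * R t / 18)"

definition U :: "pt \<Rightarrow> real" where
  "U = (\<lambda>p. R (fst p) ^ 2 * (w (Z p) + P p))"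

definition D :: "pt set" where
  "D = {(t, x, y). t \<in> I \<and> Z (t, x, y) \<in> J}"

lemma smooth_derivs: "smooth_on I f1" "smooth_on I f2" "smooth_on J w1"
  using smooth_on_realD(2) open_I open_J smooth_f smooth_w by auto

lemma has_derivs:
  "t \<in> I \<Longrightarrow> (f has_real_derivative f1 t) (at t)"
  "t \<in> I \<Longrightarrow> (f1 has_real_derivative f2 t) (at t)"
  "t \<in> I \<Longrightarrow> (f2 has_real_derivative f3 t) (at t)"
  "z \<in> J \<Longrightarrow> (w has_real_derivative w1 z) (at z)"
  "z \<in> J \<Longrightarrow> (w1 has_real_derivative w2 z) (at z)"
  using smooth_on_realD(1) smooth_derivs open_I open_J smooth_f smooth_w by auto

lemma f_mult_R: "t \<in> I \<Longrightarrow> f t * R t ^ 3 = 1"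
  using f_nz[of t] by (simp add: R_def power_inverse odd_real_root_pow)

lemma R_nz: "t \<in> I \<Longrightarrow> R t \<noteq> 0"
  using f_nz[of t] by (simp add: R_def)

lemma has_derivative_R:
  assumes "t \<in> I"
  shows "(R has_real_derivative - f1 t * R t ^ 4 / 3) (at t)"
proof -
  have "((\<lambda>t. inverse (root 3 (f t))) has_real_derivative
      - (inverse (root 3 (f t)) * (1 / 3 * inverse (root 3 (f t) ^ 2) * f1 t) * inverse (root 3 (f t)))) (at t)"
    by (rule DERIV_inverse'[OF DERIV_chain2[OF has_real_derivative_root3 has_derivs(1)]])
      (use assms f_nz in auto)
  moreover have "- (inverse \<rho> * (1 / 3 * inverse (\<rho> ^ 2) * a) * inverse \<rho>) = - a * inverse \<rho> ^ 4 / 3"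
    for \<rho> a :: real
    by (simp add: power2_eq_square power4_eq_xxxx)
  ultimately show ?thesis
    unfolding R_def[abs_def] by metis
qed

lemma deriv_funpow: "(deriv ^^ 2) g = deriv (deriv g)" "(deriv ^^ 3) g = deriv (deriv (deriv g))"
  by (simp_all add: numeral_2_eq_2 numeral_3_eq_3)

lemma divide_root: "a / root 3 (f t) ^ n = a * R t ^ n" "a / (c * root 3 (f t) ^ n) = a * R t ^ n / c"
  "a / (c * root 3 (f t)) = a * R t / c"
  unfolding R_def divide_inverse power_inverse inverse_mult_distrib by (simp_all only: ac_simps)

lemma zvar_eq:
  assumes "t \<in> I"
  shows "zvar K f (t, x, y) = Z (t, x, y)"
proof -
  have "zvar K f (t, x, y) = 12 * x * (f t * R t ^ 4) + y\<^sup>2 * (K - 2 * f1 t) * R t ^ 4"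
    unfolding zvar_def prod.case divide_root by algebra
  also have "f t * R t ^ 4 = R t"
    using f_mult_R[OF assms] by algebra
  finally show ?thesis
    by (simp add: Z_def)
qed

lemma ansatz_eq:
  assumes "t \<in> I"
  shows "ansatz K f w (t, x, y) = U (t, x, y)"
  unfolding ansatz_def U_def P_def prod.case fst_conv zvar_eq[OF assms] divide_root deriv_funpow
  by algebra

lemma D_eq: "{(t, x, y). t \<in> I \<and> zvar K f (t, x, y) \<in> J} = D"
  by (auto simp: D_def zvar_eq)

lemma smooth_R: "smooth_on I R"
  unfolding R_def
  by (intro smooth_on_compose[OF smooth_on_inverse open_nonzero open_I]
      smooth_on_compose[OF smooth_on_root3 open_nonzero open_I] smooth_f) (use f_nz in auto)

text \<open>Stated for a general \<open>S\<close> because it is needed on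
  \<open>I \<times> UNIV\<close> to prove that \<open>D\<close> is open, and then on
  \<open>D\<close> itself.\<close>

lemma smooth_polys:
  assumes "open S" and "\<And>p. p \<in> S \<Longrightarrow> fst p \<in> I"
  shows "smooth_on S (\<lambda>p :: pt. R (fst p))" and "smooth_on S Z" and "smooth_on S P"
proof -
  have coords: "smooth_on S (\<lambda>p :: pt. fst p)" "smooth_on S (\<lambda>p :: pt. fst (snd p))"
    "smooth_on S (\<lambda>p :: pt. snd (snd p))"
    by (intro smooth_on_bounded_linear assms(1) bounded_linear_intros)+
  have comp: "smooth_on S (\<lambda>p :: pt. \<phi> (fst p))" if "smooth_on I \<phi>" for \<phi>
    by (rule smooth_on_compose[OF that open_I assms(1) coords(1) assms(2)])
  note intros = smooth_on_add smooth_on_diff smooth_on_mult smooth_on_power smooth_on_const assms(1)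
    coords comp[OF smooth_R] comp[OF smooth_derivs(1)] comp[OF smooth_derivs(2)]
  show "smooth_on S (\<lambda>p :: pt. R (fst p))"
    by (rule comp[OF smooth_R])
  show "smooth_on S Z"
    unfolding Z_def case_prod_beta by (intro intros)
  \<comment> \<open>Negation and division by 18 become a constant factor, so that the closure rules
    for sums, differences, products and powers apply.\<close>
  have "P = (\<lambda>p. (- 1 / 18) * ((snd (snd p))\<^sup>2 * f1 (fst p) * (K - 2 * f1 (fst p)) * R (fst p) ^ 4)
      + (- 1 / 18) * ((- 6 * K * fst (snd p) + 6 * fst (snd p) * f1 (fst p)
        + 3 * (snd (snd p))\<^sup>2 * f2 (fst p)) * R (fst p)))"
    by (auto simp: P_def fun_eq_iff)
  moreover have "smooth_on S \<dots>"
    by (intro intros)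
  ultimately show "smooth_on S P"
    by simp
qed

lemma open_D: "open D"
proof -
  have S: "open (I \<times> (UNIV :: (real \<times> real) set))"
    by (simp add: open_I open_Times)
  have "smooth_on (I \<times> UNIV) Z"
    by (rule smooth_polys(2)[OF S]) auto
  then have "continuous_on (I \<times> UNIV) Z"
    unfolding smooth_on_def by (metis C_on.simps(1))
  then have "open ((I \<times> UNIV) \<inter> Z -` J)"
    using S open_J by (simp add: continuous_on_open_vimage Int_commute continuous_open_preimage)
  also have "(I \<times> UNIV) \<inter> Z -` J = D"
    by (auto simp: D_def)
  finally show ?thesis .
qed

lemma smooth_U: "smooth_on D U"
proof -
  have D: "\<And>p. p \<in> D \<Longrightarrow> fst p \<in> I" "\<And>p. p \<in> D \<Longrightarrow> Z p \<in> J"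
    by (auto simp: D_def)
  show ?thesis
    unfolding U_def
    by (intro smooth_on_mult smooth_on_add smooth_on_power open_D smooth_polys D
        smooth_on_compose[OF smooth_w open_J])
qed

text \<open>\<open>V\<close> is \<open>f u\<^sub>t\<close>, cleared of \<open>f\<close> by means of \<open>f R\<^sup>3 = 1\<close>.\<close>

definition V :: "pt \<Rightarrow> real" where
  "V = (\<lambda>(t, x, y). - 2 / 3 * f1 t * U (t, x, y)
      + w1 (Z (t, x, y)) * (- 4 * x * f1 t * R t ^ 3 - 2 * y\<^sup>2 * f2 t * R t ^ 3
          - 4 / 3 * y\<^sup>2 * (K - 2 * f1 t) * f1 t * R t ^ 6)
      - y\<^sup>2 / 18 * (f2 t * (K - 4 * f1 t) * R t ^ 3 - 4 / 3 * f1 t ^ 2 * (K - 2 * f1 t) * R t ^ 6)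
      - (6 * x * f2 t + 3 * y\<^sup>2 * f3 t) / 18
      + (- 6 * K * x + 6 * x * f1 t + 3 * y\<^sup>2 * f2 t) * f1 t * R t ^ 3 / 54)"

text \<open>\<open>Ux\<close>, \<open>Uy\<close> and \<open>Zt\<close> are closed forms of the
  partials \<open>u_x\<close>, \<open>u_y\<close>, \<open>z_t\<close>. In \<open>Ux\<close> the
  variables \<open>x\<close> and \<open>y\<close> enter only through \<open>Z\<close>.\<close>

definition Ux :: "pt \<Rightarrow> real" where
  "Ux = (\<lambda>(t, x, y). R t ^ 3 * (12 * w1 (Z (t, x, y)) + (K - f1 t) / 3))"

definition Uy :: "pt \<Rightarrow> real" where
  "Uy = (\<lambda>(t, x, y). R t ^ 2 * (w1 (Z (t, x, y)) * (2 * y * (K - 2 * f1 t) * R t ^ 4)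
      - y * f1 t * (K - 2 * f1 t) * R t ^ 4 / 9 - y * f2 t * R t / 3))"

definition Zt :: "pt \<Rightarrow> real" where
  "Zt = (\<lambda>(t, x, y). - 4 * x * f1 t * R t ^ 4 - 2 * y\<^sup>2 * f2 t * R t ^ 4
          - 4 / 3 * y\<^sup>2 * (K - 2 * f1 t) * f1 t * R t ^ 7)"

section \<open>First and second partial derivatives of the ansatz\<close>

context
  fixes t x y
  assumes mem: "(t, x, y) \<in> D"
begin

lemma tI: "t \<in> I" and zJ: "Z (t, x, y) \<in> J"
  using mem by (auto simp: D_def)

lemma Z_partials:
  "((\<lambda>s. Z (s, x, y)) has_real_derivative Zt (t, x, y)) (at t)"
  "((\<lambda>s. Z (t, s, y)) has_real_derivative 12 * R t) (at x)"
  "((\<lambda>s. Z (t, x, s)) has_real_derivative 2 * y * (K - 2 * f1 t) * R t ^ 4) (at y)"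
  unfolding Z_def Zt_def prod.case
  by (rule DERIV_cong, (rule polynomial_deriv_rules has_derivs has_derivative_R tI)+, algebra)+

lemmas w_w1_partials =
  DERIV_chain2[OF has_derivs(4)[OF zJ] Z_partials(1)]
  DERIV_chain2[OF has_derivs(4)[OF zJ] Z_partials(2)]
  DERIV_chain2[OF has_derivs(4)[OF zJ] Z_partials(3)]
  DERIV_chain2[OF has_derivs(5)[OF zJ] Z_partials(1)]
  DERIV_chain2[OF has_derivs(5)[OF zJ] Z_partials(2)]
  DERIV_chain2[OF has_derivs(5)[OF zJ] Z_partials(3)]

lemma U_partials:
  "((\<lambda>s. U (s, x, y)) has_real_derivative R t ^ 3 * V (t, x, y)) (at t)"
  "((\<lambda>s. U (t, s, y)) has_real_derivative Ux (t, x, y)) (at x)"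
  "((\<lambda>s. U (t, x, s)) has_real_derivative Uy (t, x, y)) (at y)"
proof -
  \<comment> \<open>Differentiating the prefactor \<open>R^2\<close> gives \<open>R^3\<close> times
    the first term of \<open>V\<close>. The remaining terms also carry a factor
    \<open>R^3\<close>.\<close>
  show "((\<lambda>s. U (s, x, y)) has_real_derivative R t ^ 3 * V (t, x, y)) (at t)"
    unfolding U_def P_def V_def prod.case fst_conv
    by (rule DERIV_cong, (rule polynomial_deriv_rules w_w1_partials has_derivs has_derivative_R tI)+)
      (simp only: Zt_def prod.case, algebra)
  show "((\<lambda>s. U (t, s, y)) has_real_derivative Ux (t, x, y)) (at x)"
    unfolding U_def P_def Ux_def prod.case fst_conv
    by (rule DERIV_cong, (rule polynomial_deriv_rules w_w1_partials has_derivs has_derivative_R tI)+,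
        simp add: field_simps eval_nat_numeral)
  show "((\<lambda>s. U (t, x, s)) has_real_derivative Uy (t, x, y)) (at y)"
    unfolding U_def P_def Uy_def prod.case fst_conv
    by (rule DERIV_cong, (rule polynomial_deriv_rules w_w1_partials has_derivs has_derivative_R tI)+,
        simp add: field_simps eval_nat_numeral)
qed

text \<open>These are the three terms of the ZK equation. As \<open>z_x = 12 R\<close>,
  differentiating \<open>Ux\<close> gives \<open>u_xx = 144 R^4 w''\<close>.\<close>

lemma U_second_partials:
  "((\<lambda>s. Ux (s, x, y)) has_real_derivative
      - f1 t * R t ^ 6 * (12 * w1 (Z (t, x, y)) + (K - f1 t) / 3)
      + R t ^ 3 * (12 * w2 (Z (t, x, y)) * Zt (t, x, y) - f2 t / 3)) (at t)"
  "((\<lambda>s. U (t, s, y) * Ux (t, s, y)) has_real_derivative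
      Ux (t, x, y) ^ 2 + 144 * R t ^ 4 * w2 (Z (t, x, y)) * U (t, x, y)) (at x)"
  "((\<lambda>s. Uy (t, x, s)) has_real_derivative
      R t ^ 2 * (w2 (Z (t, x, y)) * (2 * y * (K - 2 * f1 t) * R t ^ 4) ^ 2
        + 2 * w1 (Z (t, x, y)) * (K - 2 * f1 t) * R t ^ 4
        - f1 t * (K - 2 * f1 t) * R t ^ 4 / 9 - f2 t * R t / 3)) (at y)"
proof -
  show "((\<lambda>s. Ux (s, x, y)) has_real_derivative
      - f1 t * R t ^ 6 * (12 * w1 (Z (t, x, y)) + (K - f1 t) / 3)
      + R t ^ 3 * (12 * w2 (Z (t, x, y)) * Zt (t, x, y) - f2 t / 3)) (at t)"
    unfolding Ux_def prod.case
    by (rule DERIV_cong, (rule polynomial_deriv_rules w_w1_partials has_derivs has_derivative_R tI)+,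
        simp add: field_simps eval_nat_numeral)
  have "((\<lambda>s. Ux (t, s, y)) has_real_derivative 144 * R t ^ 4 * w2 (Z (t, x, y))) (at x)"
    unfolding Ux_def prod.case
    by (rule DERIV_cong, (rule polynomial_deriv_rules w_w1_partials has_derivs has_derivative_R tI)+,
        simp add: field_simps eval_nat_numeral)
  from DERIV_mult[OF U_partials(2) this]
  show "((\<lambda>s. U (t, s, y) * Ux (t, s, y)) has_real_derivative
      Ux (t, x, y) ^ 2 + 144 * R t ^ 4 * w2 (Z (t, x, y)) * U (t, x, y)) (at x)"
    by (simp add: power2_eq_square)
  show "((\<lambda>s. Uy (t, x, s)) has_real_derivative
      R t ^ 2 * (w2 (Z (t, x, y)) * (2 * y * (K - 2 * f1 t) * R t ^ 4) ^ 2
        + 2 * w1 (Z (t, x, y)) * (K - 2 * f1 t) * R t ^ 4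
        - f1 t * (K - 2 * f1 t) * R t ^ 4 / 9 - f2 t * R t / 3)) (at y)"
    unfolding Uy_def prod.case
    by (rule DERIV_cong, (rule polynomial_deriv_rules w_w1_partials has_derivs has_derivative_R tI)+,
        simp add: field_simps eval_nat_numeral)
qed

text \<open>Smoothness supplies differentiability; the computed partials then identify the
  derivative.\<close>

lemma U_has_derivative:
  "(U has_derivative (\<lambda>(\<tau>, \<xi>, \<eta>). R t ^ 3 * V (t, x, y) * \<tau> + Ux (t, x, y) * \<xi> + Uy (t, x, y) * \<eta>))
    (at (t, x, y))"
proof (rule has_derivative_partials[OF _ U_partials])
  have "C_on (Suc 0) D U"
    using smooth_U unfolding smooth_on_def by blast
  then show "U differentiable (at (t, x, y))"
    using mem by simp
qed

end

section \<open>The ZK equation and the reduced equation\<close>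

lemma part_U:
  assumes "p \<in> D"
  shows "part_x U p = Ux p" and "part_y U p = Uy p"
  using assms U_partials(2,3)
  by (cases p; auto simp: part_x_def part_y_def intro!: DERIV_imp_deriv)+

definition ode :: "real \<Rightarrow> real" where
  "ode z = K\<^sup>2 + 90 * K * w1 z + 1296 * (w1 z)\<^sup>2 + 36 * (36 * w z + K * z) * w2 z"

lemma residual_U:
  assumes "p \<in> D"
  shows "part_t (part_x U) p - part_x (\<lambda>q. U q * part_x U q) p - part_y (part_y U) p
    = - (R (fst p) ^ 6 / 9) * ode (Z p)"
proof -
  obtain t x y where p: "p = (t, x, y)"
    by (cases p)
  have mem: "(t, x, y) \<in> D"
    using assms p by simp
  have "part_t (part_x U) p = part_t Ux p"
    by (rule part_cong(1)[OF open_D part_U(1) assms])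
  also have "\<dots> = - f1 t * R t ^ 6 * (12 * w1 (Z (t, x, y)) + (K - f1 t) / 3)
      + R t ^ 3 * (12 * w2 (Z (t, x, y)) * Zt (t, x, y) - f2 t / 3)"
    unfolding p part_t_def prod.case by (rule DERIV_imp_deriv[OF U_second_partials(1)[OF mem]])
  finally have 1: "part_t (part_x U) p = \<dots>" .
  have "part_x (\<lambda>q. U q * part_x U q) p = part_x (\<lambda>q. U q * Ux q) p"
    by (rule part_cong(2)[OF open_D _ assms]) (simp add: part_U)
  also have "\<dots> = Ux (t, x, y) ^ 2 + 144 * R t ^ 4 * w2 (Z (t, x, y)) * U (t, x, y)"
    unfolding p part_x_def prod.case by (rule DERIV_imp_deriv[OF U_second_partials(2)[OF mem]])
  finally have 2: "part_x (\<lambda>q. U q * part_x U q) p = \<dots>" .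
  have "part_y (part_y U) p = part_y Uy p"
    by (rule part_cong(3)[OF open_D part_U(2) assms])
  also have "\<dots> = R t ^ 2 * (w2 (Z (t, x, y)) * (2 * y * (K - 2 * f1 t) * R t ^ 4) ^ 2
        + 2 * w1 (Z (t, x, y)) * (K - 2 * f1 t) * R t ^ 4
        - f1 t * (K - 2 * f1 t) * R t ^ 4 / 9 - f2 t * R t / 3)"
    unfolding p part_y_def prod.case by (rule DERIV_imp_deriv[OF U_second_partials(3)[OF mem]])
  finally have 3: "part_y (part_y U) p = \<dots>" .
  \<comment> \<open>The values of \<open>w\<close>, \<open>w'\<close>, \<open>w''\<close> are frozen
    as atoms before \<open>z\<close> is expanded. The expansion is needed because \<open>ode\<close>
    contains \<open>z\<close> explicitly.\<close>
  define \<zeta> W W1 W2 where W: "\<zeta> = Z (t, x, y)" "W = w \<zeta>" "W1 = w1 \<zeta>" "W2 = w2 \<zeta>"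
  have \<zeta>: "\<zeta> = 12 * x * R t + y\<^sup>2 * (K - 2 * f1 t) * R t ^ 4"
    by (simp add: W Z_def)
  show ?thesis
    unfolding 1 2 3
    unfolding p ode_def Zt_def Ux_def U_def P_def prod.case fst_conv
    unfolding W(1)[symmetric] unfolding W(2-4)[symmetric] unfolding \<zeta>
    by (simp add: field_simps eval_nat_numeral)
qed

lemma solves_ZK_U_iff:
  assumes "I \<noteq> {}"
  shows "solves_ZK D U \<longleftrightarrow> (\<forall>z\<in>J. ode z = 0)"
proof
  assume sol: "solves_ZK D U"
  show "\<forall>z\<in>J. ode z = 0"
  proof
    fix z assume "z \<in> J"
    obtain t where t: "t \<in> I"
      using assms by blast
    \<comment> \<open>For \<open>y = 0\<close> the equation \<open>Z = z\<close> reads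
      \<open>12 x R = z\<close> and is solved for \<open>x\<close>.\<close>
    define p where "p = (t, z / (12 * R t), 0 :: real)"
    have Z: "Z p = z"
      using R_nz[OF t] by (simp add: p_def Z_def)
    then have "p \<in> D"
      using t \<open>z \<in> J\<close> by (simp add: D_def p_def)
    then have "- (R t ^ 6 / 9) * ode z = 0"
      using sol residual_U[of p] Z by (simp add: solves_ZK_def p_def)
    then show "ode z = 0"
      using R_nz[OF t] by simp
  qed
next
  assume "\<forall>z\<in>J. ode z = 0"
  then have "ode (Z p) = 0" if "p \<in> D" for p
    using that by (auto simp: D_def)
  then show "solves_ZK D U"
    by (simp add: solves_ZK_def smooth_U residual_U)
qed

lemma solves_ZK_ansatz_iff:
  assumes "I \<noteq> {}"
  shows "solves_ZK D (ansatz K f w) \<longleftrightarrow> (\<forall>z\<in>J. reduced_ODE_at K w z)"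
proof -
  have eq: "ansatz K f w p = U p" if "p \<in> D" for p
    using that ansatz_eq by (auto simp: D_def)
  have "solves_ZK D (ansatz K f w) \<longleftrightarrow> solves_ZK D U"
    using solves_ZK_cong[of D "ansatz K f w" U, OF open_D eq]
      solves_ZK_cong[of D U "ansatz K f w", OF open_D eq[symmetric]] by blast
  then show ?thesis
    by (simp add: solves_ZK_U_iff[OF assms] ode_def reduced_ODE_at_def deriv_funpow)
qed

section \<open>Invariance under the two vector fields\<close>

lemma invariant_on_ansatzI:
  assumes "\<And>t x y. (t, x, y) \<in> D \<Longrightarrow> \<exists>a b c.
      X (t, x, y, U (t, x, y)) = (a, b, c, R t ^ 3 * V (t, x, y) * a + Ux (t, x, y) * b + Uy (t, x, y) * c)"
  shows "invariant_on D (ansatz K f w) X"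
  unfolding invariant_on_def
proof (clarify)
  fix t x y assume mem: "(t, x, y) \<in> D"
  let ?L = "\<lambda>(\<tau>, \<xi>, \<eta>). R t ^ 3 * V (t, x, y) * \<tau> + Ux (t, x, y) * \<xi> + Uy (t, x, y) * \<eta>"
  have eq: "U p = ansatz K f w p" if "p \<in> D" for p
    using that ansatz_eq by (auto simp: D_def)
  have "(ansatz K f w has_derivative ?L) (at (t, x, y))"
    by (rule has_derivative_transform_within_open[OF U_has_derivative[OF mem] open_D mem eq])
  moreover have "\<exists>a b c. X (t, x, y, ansatz K f w (t, x, y)) = (a, b, c, ?L (a, b, c))"
    using assms[OF mem] eq[OF mem] by simp
  ultimately show "\<exists>L. (ansatz K f w has_derivative L) (at (t, x, y)) \<and>
      (\<exists>a b c. X (t, x, y, ansatz K f w (t, x, y)) = (a, b, c, L (a, b, c)))"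
    by blast
qed

lemma invariant_vf_z: "invariant_on D (ansatz K f w) (vf_z f)"
proof (rule invariant_on_ansatzI)
  fix t x y assume mem: "(t, x, y) \<in> D"
  have fR: "f t * R t ^ 3 = 1"
    by (rule f_mult_R[OF tI[OF mem]])
  \<comment> \<open>With this, \<open>f\<close> survives only through \<open>R\<close> and its
    derivatives. What remains is a polynomial identity: \<open>U\<close> cancels as an atom, and the
    terms in \<open>w'\<close> cancel because \<open>z\<close> is invariant under the field.\<close>
  have t: "R t ^ 3 * V (t, x, y) * f t = V (t, x, y)"
    using fR by algebra
  have "1 / 6 * (- 4 * U (t, x, y) * f1 t - 2 * x * f2 t - y\<^sup>2 * f3 t)
      = R t ^ 3 * V (t, x, y) * f t + Ux (t, x, y) * (1 / 6 * (2 * x * f1 t + y\<^sup>2 * f2 t))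
        + Uy (t, x, y) * (2 * y / 3 * f1 t)"
    unfolding t unfolding V_def Ux_def Uy_def prod.case by (simp add: field_simps eval_nat_numeral)
  then show "\<exists>a b c. vf_z f (t, x, y, U (t, x, y)) =
      (a, b, c, R t ^ 3 * V (t, x, y) * a + Ux (t, x, y) * b + Uy (t, x, y) * c)"
    unfolding vf_z_def prod.case deriv_funpow by blast
qed

lemma invariant_vf_y:
  assumes h: "\<And>t. t \<in> I \<Longrightarrow> (h has_real_derivative h t * (2 * f1 t - K) * R t ^ 3 / 3) (at t)"
  shows "invariant_on D (ansatz K f w) (vf_y h)"
proof (rule invariant_on_ansatzI)
  fix t x y assume mem: "(t, x, y) \<in> D"
  have t: "t \<in> I"
    by (rule tI[OF mem])
  have h1: "deriv h s = h s * (2 * f1 s - K) * R s ^ 3 / 3" if "s \<in> I" for s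
    by (rule DERIV_imp_deriv[OF h[OF that]])
  \<comment> \<open>The second derivative of \<open>h\<close> comes from differentiating the formula
    for the first, which holds on all of the open set \<open>I\<close>.\<close>
  have "((\<lambda>s. h s * (2 * f1 s - K) * R s ^ 3 / 3) has_real_derivative
      h t * R t ^ 3 * (2 * f2 t - (2 * f1 t - K) * (f1 t + K) * R t ^ 3 / 3) / 3) (at t)"
    by (rule DERIV_cong, (rule polynomial_deriv_rules h has_derivs has_derivative_R t)+,
        simp add: field_simps eval_nat_numeral)
  then have "(deriv h has_real_derivative
      h t * R t ^ 3 * (2 * f2 t - (2 * f1 t - K) * (f1 t + K) * R t ^ 3 / 3) / 3) (at t)"
    by (rule has_field_derivative_transform_within_open[OF _ open_I t]) (simp add: h1)
  then have h2: "deriv (deriv h) t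
      = h t * R t ^ 3 * (2 * f2 t - (2 * f1 t - K) * (f1 t + K) * R t ^ 3 / 3) / 3"
    by (rule DERIV_imp_deriv)
  \<comment> \<open>The terms in \<open>w'\<close> cancel here too, \<open>z\<close> being invariant
    under this field; the rest is linear in \<open>h\<close>.\<close>
  have "- 1 / 2 * y * deriv (deriv h) t
      = R t ^ 3 * V (t, x, y) * 0 + Ux (t, x, y) * (1 / 2 * y * deriv h t) + Uy (t, x, y) * h t"
    unfolding h1[OF t] h2 Ux_def Uy_def prod.case by (simp add: field_simps eval_nat_numeral)
  then show "\<exists>a b c. vf_y h (t, x, y, U (t, x, y)) =
      (a, b, c, R t ^ 3 * V (t, x, y) * a + Ux (t, x, y) * b + Uy (t, x, y) * c)"
    unfolding vf_y_def prod.case deriv_funpow by blast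
qed

text \<open>\<open>F\<close> plays the integral of \<open>K/f\<close>. Cubing removes the root: both
  sides of \<open>h^3 = C^3 f^2 exp (- F)\<close> are differentiated, and the result is divided by
  \<open>h^2\<close>.\<close>

lemma has_derivative_h:
  assumes F: "\<And>t. t \<in> I \<Longrightarrow> (F has_real_derivative K / f t) (at t)"
    and h: "\<And>t. t \<in> I \<Longrightarrow> h t = C * root 3 ((f t)\<^sup>2 * exp (- F t))"
    and smooth: "smooth_on I h" and nz: "\<And>t. t \<in> I \<Longrightarrow> h t \<noteq> 0" and t: "t \<in> I"
  shows "(h has_real_derivative h t * (2 * f1 t - K) * R t ^ 3 / 3) (at t)"
proof -
  have h': "(h has_real_derivative deriv h t) (at t)"
    by (rule smooth_on_realD(1)[OF open_I smooth t])
  have cube: "h s ^ 3 = C ^ 3 * ((f s)\<^sup>2 * exp (- F s))" if "s \<in> I" for s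
    by (simp add: h[OF that] power_mult_distrib odd_real_root_pow)
  have "((\<lambda>s. h s ^ 3) has_real_derivative 3 * (deriv h t * (h t)\<^sup>2)) (at t)"
    using DERIV_power[OF h', of 3] by (simp add: power2_eq_square)
  moreover have "((\<lambda>s. C ^ 3 * ((f s)\<^sup>2 * exp (- F s))) has_real_derivative
      C ^ 3 * (2 * f t * f1 t * exp (- F t) - (f t)\<^sup>2 * exp (- F t) * (K / f t))) (at t)"
    by (auto intro!: derivative_eq_intros F[OF t] has_derivs(1)[OF t])
  then have "((\<lambda>s. h s ^ 3) has_real_derivative
      C ^ 3 * (2 * f t * f1 t * exp (- F t) - (f t)\<^sup>2 * exp (- F t) * (K / f t))) (at t)"
    by (rule has_field_derivative_transform_within_open[OF _ open_I t]) (simp add: cube)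
  ultimately have "3 * (deriv h t * (h t)\<^sup>2)
      = C ^ 3 * (2 * f t * f1 t * exp (- F t) - (f t)\<^sup>2 * exp (- F t) * (K / f t))"
    by (rule DERIV_unique)
  \<comment> \<open>Naming the quotient \<open>K / f\<close> makes the relations polynomial, as
    \<open>algebra\<close> requires.\<close>
  moreover obtain q where "K / f t = q" "K = q * f t"
    using f_nz[OF t] that[of "K / f t"] by simp
  ultimately have "3 * (deriv h t * (h t)\<^sup>2) * f t = h t ^ 3 * (2 * f1 t - K)"
    unfolding cube[OF t] by algebra
  then have "(h t)\<^sup>2 * (3 * deriv h t * f t) = (h t)\<^sup>2 * (h t * (2 * f1 t - K))"
    by (simp add: power2_eq_square power3_eq_cube mult_ac)
  then have "3 * deriv h t * f t = h t * (2 * f1 t - K)"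
    using nz[OF t] by simp
  then have "deriv h t = h t * (2 * f1 t - K) * R t ^ 3 / 3"
    using f_mult_R[OF t] by algebra
  with h' show ?thesis
    by simp
qed

end

subsection \<open>The square-root solutions\<close>

lemma open_sqrt_domain: "open {z :: real. 2 * z - \<alpha> > 0}"
  by (intro open_Collect_less continuous_intros)

lemma smooth_on_scaled_sqrt: "smooth_on {z. 2 * z - \<alpha> > 0} (\<lambda>z. \<beta> * sqrt (2 * z - \<alpha>))"
proof -
  have "smooth_on {z :: real. 2 * z - \<alpha> > 0} (\<lambda>z. 2 * z - \<alpha>)"
    by (intro smooth_on_diff smooth_on_mult smooth_on_const smooth_on_bounded_linear
        bounded_linear_ident open_sqrt_domain)
  then have "smooth_on {z. 2 * z - \<alpha> > 0} (\<lambda>z. sqrt (2 * z - \<alpha>))"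
    by (rule smooth_on_compose[OF smooth_on_sqrt open_greaterThan open_sqrt_domain]) simp
  then show ?thesis
    by (intro smooth_on_mult smooth_on_const open_sqrt_domain)
qed

text \<open>The equation says \<open>(w w')' = 0\<close>, and here \<open>w w'\<close> is the
  constant \<open>\<beta>^2\<close>. The proof computes both derivatives explicitly.\<close>

lemma reduced_ODE0_scaled_sqrt:
  assumes "2 * z - \<alpha> > 0"
  shows "reduced_ODE0_at (\<lambda>z. \<beta> * sqrt (2 * z - \<alpha>)) z"
proof -
  let ?w = "\<lambda>z. \<beta> * sqrt (2 * z - \<alpha>)" and ?S = "{z. 2 * z - \<alpha> > 0}"
  have d1: "deriv ?w v = \<beta> / sqrt (2 * v - \<alpha>)" if "v \<in> ?S" for v
    by (rule DERIV_imp_deriv) (use that in \<open>auto intro!: derivative_eq_intros simp: field_simps\<close>)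
  have pos: "sqrt (2 * z - \<alpha>) > 0"
    using assms by simp
  have "((\<lambda>v. \<beta> / sqrt (2 * v - \<alpha>)) has_real_derivative - \<beta> / sqrt (2 * z - \<alpha>) ^ 3) (at z)"
    using assms pos by (auto intro!: derivative_eq_intros simp: field_simps power3_eq_cube)
  then have "(deriv ?w has_real_derivative - \<beta> / sqrt (2 * z - \<alpha>) ^ 3) (at z)"
    by (rule has_field_derivative_transform_within_open[OF _ open_sqrt_domain]) (use assms d1 in auto)
  then have "(deriv ^^ 2) ?w z = - \<beta> / sqrt (2 * z - \<alpha>) ^ 3"
    by (simp add: numeral_2_eq_2 DERIV_imp_deriv)
  moreover have "deriv ?w z = \<beta> / sqrt (2 * z - \<alpha>)"
    using assms d1 by simp
  moreover have "(\<beta> / r)\<^sup>2 + \<beta> * r * (- \<beta> / r ^ 3) = 0" if "r > 0" for r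
    using that by (simp add: field_simps power2_eq_square power3_eq_cube)
  ultimately show ?thesis
    using pos unfolding reduced_ODE0_at_def by presburger
qed

text \<open>Consequently the radicand is positive exactly where \<open>z\<close> lies in the domain
  chosen for the square root.\<close>

lemma radicand_eq: "2 * zvar 0 f (t, x, y) - \<alpha> = radicand f \<alpha> (t, x, y)"
  by (simp add: zvar_def radicand_def diff_divide_distrib)

lemma ansatz_sqrt_eq:
  assumes "f t \<noteq> 0"
  shows "ansatz 0 f (\<lambda>z. \<beta> * sqrt (2 * z - \<alpha>)) (t, x, y) = sqrt_solution f \<alpha> \<beta> (t, x, y)"
proof -
  \<comment> \<open>With \<open>r\<close> the cube root of \<open>f\<close> and
    \<open>f = r^3\<close>, the two formulas agree as rational functions of
    \<open>r\<close>.\<close>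
  have "1 / r ^ 2 * (\<beta> * s - y\<^sup>2 * a * (0 - 2 * a) / (18 * r ^ 4)
        - (- 6 * 0 * x + 6 * x * a + 3 * y\<^sup>2 * b) / (18 * r))
      = 1 / (18 * c\<^sup>2) * (2 * y\<^sup>2 * a\<^sup>2 - 3 * c * (2 * x * a + y\<^sup>2 * b) + 18 * \<beta> * r ^ 4 * s)"
    if "r \<noteq> 0" and c: "c = r ^ 3" for r s a b c :: real
    using that(1) unfolding c by (simp add: field_simps eval_nat_numeral)
  moreover have "root 3 (f t) \<noteq> 0" "f t = root 3 (f t) ^ 3"
    using assms by (simp_all add: odd_real_root_pow)
  ultimately show ?thesis
    unfolding ansatz_def sqrt_solution_def prod.case radicand_eq by blast
qed


theorem mainTheorem9:
  fixes I J :: "real set" and f h F w :: "real \<Rightarrow> real" and K C :: real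
  assumes "open I" and "is_interval I" and "I \<noteq> {}"
    and "smooth_on I f" and "\<forall>t\<in>I. f t \<noteq> 0"
    and "smooth_on I h" and "\<forall>t\<in>I. h t \<noteq> 0"
    and "C \<noteq> 0"
    and "\<forall>t\<in>I. (F has_real_derivative K / f t) (at t)"
    and "\<forall>t\<in>I. h t = C * root 3 ((f t)\<^sup>2 * exp (- F t))"
    and "open J" and "smooth_on J w"
  defines "D \<equiv> {(t, x, y). t \<in> I \<and> zvar K f (t, x, y) \<in> J}"
  shows "invariant_on D (ansatz K f w) (vf_y h)
    \<and> invariant_on D (ansatz K f w) (vf_z f)
    \<and> (solves_ZK D (ansatz K f w) \<longleftrightarrow> (\<forall>z\<in>J. reduced_ODE_at K w z))
    \<and> (K = 0 \<longrightarrow>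
        (\<forall>z\<in>J. reduced_ODE_at K w z \<longleftrightarrow> reduced_ODE0_at w z)
        \<and> (\<forall>\<alpha> \<beta>.
             smooth_on {z. 2 * z - \<alpha> > 0} (\<lambda>z. \<beta> * sqrt (2 * z - \<alpha>))
             \<and> (\<forall>z. 2 * z - \<alpha> > 0 \<longrightarrow> reduced_ODE0_at (\<lambda>z. \<beta> * sqrt (2 * z - \<alpha>)) z)
             \<and> (\<forall>t x y. t \<in> I \<longrightarrow> radicand f \<alpha> (t, x, y) > 0 \<longrightarrow>
                  ansatz K f (\<lambda>z. \<beta> * sqrt (2 * z - \<alpha>)) (t, x, y) = sqrt_solution f \<alpha> \<beta> (t, x, y))
             \<and> solves_ZK {(t, x, y). t \<in> I \<and> radicand f \<alpha> (t, x, y) > 0} (sqrt_solution f \<alpha> \<beta>)))"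
proof -
  interpret zk_reduction I J f w K
    using assms by unfold_locales auto
  have D: "D = zk_reduction.D I J f K"
    unfolding assms by (rule D_eq)
  have "invariant_on D (ansatz K f w) (vf_y h)"
    unfolding D using assms by (intro invariant_vf_y has_derivative_h[of F h C]) auto
  moreover have "invariant_on D (ansatz K f w) (vf_z f)"
    unfolding D by (rule invariant_vf_z)
  moreover have "solves_ZK D (ansatz K f w) \<longleftrightarrow> (\<forall>z\<in>J. reduced_ODE_at K w z)"
    unfolding D by (rule solves_ZK_ansatz_iff[OF assms(3)])
  \<comment> \<open>For \<open>K = 0\<close> the left-hand side is 1296 times that of the simpler
    equation.\<close>
  moreover have "reduced_ODE_at 0 w z \<longleftrightarrow> reduced_ODE0_at w z" for w z
    unfolding reduced_ODE_at_def reduced_ODE0_at_def by (auto simp: algebra_simps)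
  moreover have "solves_ZK {(t, x, y). t \<in> I \<and> radicand f \<alpha> (t, x, y) > 0} (sqrt_solution f \<alpha> \<beta>)" for \<alpha> \<beta>
  proof -
    let ?w = "\<lambda>z. \<beta> * sqrt (2 * z - \<alpha>)" and ?J = "{z. 2 * z - \<alpha> > 0}"
    interpret S: zk_reduction I ?J f ?w 0
      using assms open_sqrt_domain smooth_on_scaled_sqrt by unfold_locales auto
    \<comment> \<open>\<open>calculation(4)\<close> is the equivalence of the two reduced equations
      at \<open>K = 0\<close>, just proved for arbitrary \<open>w\<close>.\<close>
    have "solves_ZK S.D (ansatz 0 f ?w)"
      unfolding S.solves_ZK_ansatz_iff[OF assms(3)] calculation(4)
      using reduced_ODE0_scaled_sqrt by blast
    moreover have "ansatz 0 f ?w p = sqrt_solution f \<alpha> \<beta> p" if "p \<in> S.D" for p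
      using that S.f_nz ansatz_sqrt_eq unfolding S.D_def by auto
    ultimately have "solves_ZK S.D (sqrt_solution f \<alpha> \<beta>)"
      by (rule solves_ZK_cong[OF S.open_D, rotated])
    then show ?thesis
      unfolding S.D_eq[symmetric] mem_Collect_eq radicand_eq .
  qed
  ultimately show ?thesis
    using assms(5) smooth_on_scaled_sqrt reduced_ODE0_scaled_sqrt ansatz_sqrt_eq by auto
qed

end
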